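(* Let $d\ge 1$ and let $A\subset\mathbb{T}^d$ be a closed set. Write $\psi=\overline{\dim}_M(\partial A)$. (i) Suppose $\mu(A)\notin\mathbb{Q}$ and $\mu(A)$ is approximable from below to order $k$, where $k\ge 1$. Then for Lebesgue-almost every $\alpha\in\mathbb{T}^d$, \[\underline{\dim}_M\big(H(A,\alpha)\big)\le \psi+\frac{d-\psi}{k}.\] (ii) Suppose $\mu(A)\in\mathbb{Q}$. Then for Lebesgue-almost every $\alpha\in\mathbb{T}^d$, \[\underline{\dim}_M\big(H(A,\alpha)\big)\le \psi.\]
   Context: $\mathbb{T}^d=\mathbb{R}^d/\mathbb{Z}^d$ with its standard quotient (translation-invariant) metric $|\cdot|$, and $\mu$ denotes Lebesgue (Haar) measure on $\mathbb{T}^d$, normalized so that $\mu(\mathbb{T}^d)=1$. $\chi_A$ is the indicator function of $A$. For $\alpha\in\mathbb{T}^d$, the strictly heavy set of $A$ with respect to rotation by $\alpha$ is \[H(A,\alpha)=\Big\{x\in\mathbb{T}^d:\ \sum_{i=0}^{n-1}\big(\chi_A(x+i\alpha \bmod 1)-\mu(A)\big)>0\ \text{for all } n\in\mathbb{N}\Big\}.\] For $S\subset\mathbb{T}^d$ and $\epsilon>0$, the packing number $N_S(\epsilon)$ is the maximal cardinality of a finite subset of $S$ whose points are pairwise at distance at least $2\epsilon$. The upper and lower Minkowski dimensions are $\overline{\dim}_M(S)=\limsup_{\epsilon\to0}\frac{\log N_S(\epsilon)}{-\log\epsilon}$ and $\underline{\dim}_M(S)=\liminf_{\epsilon\to0}\frac{\log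 N_S(\epsilon)}{-\log\epsilon}$ (with the conclusion understood as trivially true if $H(A,\alpha)=\emptyset$). $\partial A$ is the topological boundary of $A$. A real number $\gamma$ is approximable from below to order $k$ if there exist a constant $c>0$ and an infinite sequence of distinct rationals $p_i/q_i$ ($q_i$ positive integers) with $0\le \gamma-\frac{p_i}{q_i}<\frac{c}{q_i^k}$ for all $i$. *)

theory Defs
  imports "HOL-Analysis.Analysis"
begin

text \<open>The torus T^d is represented by the fundamental domain [0,1)^d inside real^'n,
  where the finite index type 'n has CARD('n) = d (always at least 1).\<close>

definition torus :: "(real^'n) set" where
  "torus = {x. \<forall>i. 0 \<le> x$i \<and> x$i < 1}"

definition tmod :: "real^'n \<Rightarrow> real^'n" where
  "tmod x = (\<chi> i. frac (x$i))"

definition tdist :: "real^'n \<Rightarrow> real^'n \<Rightarrow> real" where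
  "tdist x y = Inf {norm (x - y - k) | k. \<forall>i. k$i \<in> \<int>}"

definition tmu :: "(real^'n) set \<Rightarrow> real" where
  "tmu A = measure lebesgue A"

definition tclosed :: "(real^'n) set \<Rightarrow> bool" where
  "tclosed A \<longleftrightarrow> A \<subseteq> torus \<and> closed {x. tmod x \<in> A}"

definition tboundary :: "(real^'n) set \<Rightarrow> (real^'n) set" where
  "tboundary A = {x \<in> torus. \<forall>e>0. (\<exists>y\<in>A. tdist x y < e) \<and> (\<exists>y\<in>torus - A. tdist x y < e)}"

definition heavy :: "(real^'n) set \<Rightarrow> real^'n \<Rightarrow> (real^'n) set" where
  "heavy A \<alpha> = {x \<in> torus. \<forall>n::nat. n \<ge> 1 \<longrightarrow>
      (\<Sum>i<n. indicator A (tmod (x + real i *\<^sub>R \<alpha>)) - tmu A) > (0::real)}"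

definition packing_number :: "(real^'n) set \<Rightarrow> real \<Rightarrow> nat" where
  "packing_number S e = Sup {card F | F. finite F \<and> F \<subseteq> S \<and>
      (\<forall>x\<in>F. \<forall>y\<in>F. x \<noteq> y \<longrightarrow> tdist x y \<ge> 2 * e)}"

definition upper_mink_dim :: "(real^'n) set \<Rightarrow> ereal" where
  "upper_mink_dim S = Limsup (at_right 0)
      (\<lambda>e. ereal (ln (real (packing_number S e)) / (- ln e)))"

definition lower_mink_dim :: "(real^'n) set \<Rightarrow> ereal" where
  "lower_mink_dim S = Liminf (at_right 0)
      (\<lambda>e. ereal (ln (real (packing_number S e)) / (- ln e)))"

definition approx_from_below :: "real \<Rightarrow> real \<Rightarrow> bool" where
  "approx_from_below \<gamma> k \<longleftrightarrow> (\<exists>c>0. \<exists>p::nat \<Rightarrow> int. \<exists>q::nat \<Rightarrow> nat.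
      inj (\<lambda>i. of_int (p i) / of_nat (q i) :: real) \<and>
      (\<forall>i. q i > 0 \<and> 0 \<le> \<gamma> - of_int (p i) / of_nat (q i) \<and>
           \<gamma> - of_int (p i) / of_nat (q i) < c / real (q i) powr k))"

end

theory Submission
  imports Defs
begin

text \<open>If \<open>p/q \<le> \<mu>(A)\<close> and \<open>x\<close> is heavy, then every ergodic sum of \<open>\<chi>\<^sub>A - p/q\<close> along the
  orbit of \<open>x\<close> is positive, hence at least \<open>1/q\<close>. If \<open>A'\<close> denotes the \<open>\<epsilon>\<close>-neighbourhood of \<open>A\<close>, the
  same lower bound holds for \<open>\<chi>\<^bsub>A'\<^esub> - p/q\<close> at every point of the \<open>\<epsilon>\<close>-neighbourhood \<open>H'\<close> of the heavy
  set. Cutting an orbit at its visits to \<open>H'\<close> shows that each visit contributes at least \<open>1/q\<close>;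
  for almost every \<open>\<alpha>\<close> all orbits are dense, so the time of the first visit is bounded, and
  integrating over the torus gives \<open>\<mu>(H') \<le> q (\<mu>(A') - p/q)\<close>. Since \<open>A' - A\<close> lies in the
  \<open>\<epsilon>\<close>-neighbourhood of \<open>\<partial>A\<close>, comparing volumes bounds \<open>N\<^sub>H(\<epsilon>)\<close> by a constant multiple of
  \<open>q (\<mu>(A) - p/q) \<epsilon>\<^bsup>-d\<^esup> + q N\<^bsub>\<partial>A\<^esub>(\<epsilon>)\<close>. For rational \<open>\<mu>(A) = p/q\<close> the first term vanishes; for
  \<open>\<mu>(A)\<close> approximable to order \<open>k\<close> one takes \<open>\<epsilon> = q\<^bsup>-k/(d-\<psi>)\<^esup>\<close>.\<close>

section \<open>The torus as a quotient\<close>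

definition lattice :: "(real^'n) set" where
  "lattice = {k. \<forall>i. k$i \<in> \<int>}"

text \<open>Taken in the whole vector space and not inside \<open>torus\<close>, so that it is open
  and lattice-periodic; Haar measure is recovered by intersecting with \<open>torus\<close>.\<close>

definition tnbhd :: "(real^'n) set \<Rightarrow> real \<Rightarrow> (real^'n) set" where
  "tnbhd S e = {y. \<exists>x\<in>S. tdist x y < e}"

lemma lattice_0 [simp]: "0 \<in> lattice"
  by (simp add: lattice_def)

lemma lattice_add: "k \<in> lattice \<Longrightarrow> l \<in> lattice \<Longrightarrow> k + l \<in> lattice"
  by (simp add: lattice_def)

lemma lattice_minus: "k \<in> lattice \<Longrightarrow> - k \<in> lattice"
  by (simp add: lattice_def)

lemma lattice_diff: "k \<in> lattice \<Longrightarrow> l \<in> lattice \<Longrightarrow> k - l \<in> lattice"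
  by (simp add: lattice_def)

lemma countable_lattice: "countable (lattice :: (real^'n) set)"
proof -
  have "lattice \<subseteq> range (\<lambda>f::'n \<Rightarrow> int. \<chi> i. real_of_int (f i))"
  proof
    fix k :: "real^'n" assume "k \<in> lattice"
    then have "k = (\<chi> i. real_of_int \<lfloor>k$i\<rfloor>)"
      by (auto simp: lattice_def vec_eq_iff elim!: Ints_cases)
    then show "k \<in> range (\<lambda>f::'n \<Rightarrow> int. \<chi> i. real_of_int (f i))"
      by (metis rangeI)
  qed
  then show ?thesis
    by (rule countable_subset) simp
qed

lemma tmod_torus [simp]: "tmod x \<in> torus"
  by (simp add: tmod_def torus_def frac_lt_1)

lemma tmod_eq_self: "x \<in> torus \<Longrightarrow> tmod x = x"
  by (simp add: tmod_def torus_def vec_eq_iff frac_eq)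

lemma tmod_lattice: "\<exists>k\<in>lattice. tmod x = x + k"
proof
  show "tmod x = x + (\<chi> i. - real_of_int \<lfloor>x$i\<rfloor>)"
    by (simp add: tmod_def vec_eq_iff frac_def)
qed (simp add: lattice_def)

lemma tmod_add_lattice:
  assumes "k \<in> lattice"
  shows "tmod (x + k) = tmod x"
proof -
  have "frac (k$i) = 0" for i
    using assms by (simp add: lattice_def)
  then show ?thesis
    by (simp add: tmod_def vec_eq_iff frac_add frac_lt_1 del: frac_eq_0_iff)
qed

lemma tdist_set: "{norm (x - y - k) | k. \<forall>i. k$i \<in> \<int>} = (\<lambda>k. norm (x - y - k)) ` lattice"
  by (auto simp: lattice_def)

text \<open>Strict bounds on the infimum are witnessed by a single lattice vector, so attainment of
  the infimum never has to be discussed. The metric facts below are stated or proved through strict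
  inequalities for this reason.\<close>

lemma tdist_less_iff: "tdist x y < e \<longleftrightarrow> (\<exists>k\<in>lattice. norm (x - y - k) < e)"
proof -
  have "(\<lambda>k. norm (x - y - k)) ` lattice \<noteq> {}"
    using lattice_0 by blast
  moreover have "bdd_below ((\<lambda>k. norm (x - y - k)) ` lattice)"
    by (intro bdd_belowI[of _ 0]) auto
  ultimately show ?thesis
    unfolding tdist_def tdist_set by (simp add: cInf_less_iff)
qed

lemma tdist_le_norm: "tdist x y \<le> norm (x - y)"
proof (rule ccontr)
  assume "\<not> ?thesis"
  then have "tdist x y < tdist x y"
    by (subst tdist_less_iff) (auto intro!: bexI[of _ 0])
  then show False by simp
qed

lemma tdist_eqI:
  assumes "\<And>e. tdist x y < e \<longleftrightarrow> tdist u v < e"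
  shows "tdist x y = tdist u v"
  using assms[of "tdist x y"] assms[of "tdist u v"] by linarith

lemma tdist_commute: "tdist x y = tdist y x"
proof (rule tdist_eqI)
  have *: "norm (y - x - (-k)) = norm (x - y - k)" for x y k :: "real^'a"
    using norm_minus_commute[of "y - x" "-k"] by (simp add: algebra_simps)
  show "tdist x y < e \<longleftrightarrow> tdist y x < e" for e
    unfolding tdist_less_iff using * lattice_minus by metis
qed

lemma tdist_add_right: "tdist (x + z) (y + z) = tdist x y"
  by (simp add: tdist_def)

lemma tdist_lattice_left:
  fixes x y k :: "real^'n"
  assumes "k \<in> lattice"
  shows "tdist (x + k) y = tdist x y"
proof (rule tdist_eqI)
  have *: "tdist (x + k) y < e" if "tdist x y < e" "k \<in> lattice" for x k :: "real^'n" and e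
  proof -
    obtain l where l: "l \<in> lattice" "norm (x - y - l) < e"
      using \<open>tdist x y < e\<close> unfolding tdist_less_iff by blast
    have "norm (x + k - y - (l + k)) < e"
      using l by (simp add: algebra_simps)
    then show ?thesis
      using lattice_add[OF l(1) that(2)] unfolding tdist_less_iff by blast
  qed
  show "tdist (x + k) y < e \<longleftrightarrow> tdist x y < e" for e
    using *[of x e k] *[of "x + k" e "- k"] assms lattice_minus by auto
qed

lemma tdist_lattice_right: "k \<in> lattice \<Longrightarrow> tdist x (y + k) = tdist x y"
  by (metis tdist_commute tdist_lattice_left)

lemma tdist_tmod_left: "tdist (tmod x) y = tdist x y"
  using tmod_lattice[of x] tdist_lattice_left by metis

lemma tdist_triangle_less:
  assumes "tdist x y < a" "tdist y z < b"
  shows "tdist x z < a + b"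
proof -
  obtain k l where k: "k \<in> lattice" "norm (x - y - k) < a" and l: "l \<in> lattice" "norm (y - z - l) < b"
    using assms unfolding tdist_less_iff by blast
  have "x - z - (k + l) = (x - y - k) + (y - z - l)"
    by simp
  then have "norm (x - z - (k + l)) < a + b"
    using le_less_trans[OF norm_triangle_ineq add_strict_mono[OF k(2) l(2)]] by (simp only:)
  then show ?thesis
    using lattice_add[OF k(1) l(1)] unfolding tdist_less_iff by (rule bexI)
qed

lemma tnbhd_lattice: "x \<in> tnbhd S e \<Longrightarrow> k \<in> lattice \<Longrightarrow> x + k \<in> tnbhd S e"
  by (auto simp: tnbhd_def tdist_lattice_right)

lemma open_tnbhd:
  fixes S :: "(real^'n) set"
  shows "open (tnbhd S e)"
proof -
  have *: "norm (x - y - k) = dist (x - k) y" for x y k :: "real^'n"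
    by (simp add: dist_norm algebra_simps)
  \<comment> \<open>The neighbourhood is the union of the Euclidean balls around all lattice
    translates of points of \<open>S\<close>.\<close>
  have "tnbhd S e = (\<Union>x\<in>S. \<Union>k\<in>lattice. ball (x - k) e)"
    unfolding tnbhd_def tdist_less_iff * by (simp add: set_eq_iff)
  then show ?thesis by (simp add: open_UN)
qed

lemma tnbhd_borel [measurable]: "tnbhd S e \<in> sets borel"
  by (simp add: open_tnbhd)

section \<open>Haar measure\<close>

lemma torus_borel [measurable]: "torus \<in> sets borel"
proof -
  have "torus = (\<Inter>i. {x::real^'n. 0 \<le> x$i} \<inter> {x. x$i < 1})"
    by (auto simp: torus_def)
  also have "\<dots> \<in> sets borel"
    by (intro sets.countable_INT'' sets.Int borel_closed borel_open
        closed_Collect_le open_Collect_less continuous_intros) simp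
  finally show ?thesis .
qed

text \<open>Cut one fundamental domain into countably many pieces and translate these into the other.\<close>

lemma emeasure_fundamental_domain:
  fixes E U V :: "(real^'n) set"
  assumes [measurable]: "E \<in> sets borel" "U \<in> sets borel" "V \<in> sets borel"
    and per: "\<And>x k. x \<in> E \<Longrightarrow> k \<in> lattice \<Longrightarrow> x + k \<in> E"
    and U: "\<And>x. \<exists>!k. k \<in> lattice \<and> x + k \<in> U"
    and V: "\<And>x. \<exists>!k. k \<in> lattice \<and> x + k \<in> V"
  shows "emeasure lborel (E \<inter> U) = emeasure lborel (E \<inter> V)"
proof -
  \<comment> \<open>\<open>P k\<close> is the piece of \<open>U\<close> that \<open>k\<close>
    carries into \<open>V\<close>, and \<open>Q k\<close> is its translate by \<open>k\<close>.
    Periodicity keeps that translate inside \<open>E\<close>.\<close>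
  define P where "P k = {x. x \<in> E \<and> x \<in> U \<and> x + k \<in> V}" for k
  define Q where "Q k = {x. x \<in> E \<and> x \<in> V \<and> x - k \<in> U}" for k
  have [measurable]: "P k \<in> sets borel" "Q k \<in> sets borel" for k
    unfolding P_def Q_def by measurable
  have "E \<inter> U = (\<Union>k\<in>lattice. P k)"
    using V by (auto simp: P_def) blast
  then have "emeasure lborel (E \<inter> U) = (\<integral>\<^sup>+k. emeasure lborel (P k) \<partial>count_space lattice)"
    using V countable_lattice
    by (subst emeasure_UN_countable[symmetric]) (auto simp: disjoint_family_on_def P_def)
  also have "emeasure lborel (P k) = emeasure lborel (Q k)" if k: "k \<in> lattice" for k
  proof -
    have "emeasure lborel (Q k) = emeasure (distr lborel borel ((+) k)) (Q k)"
      by (simp add: lborel_distr_plus)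
    also have "\<dots> = emeasure lborel (((+) k) -` Q k \<inter> space lborel)"
      by (intro emeasure_distr) auto
    also have "((+) k) -` Q k \<inter> space lborel = P k"
      using per[OF _ k] per[OF _ lattice_minus[OF k]]
      by (auto simp: P_def Q_def add.commute) (metis add_diff_cancel_left' diff_conv_add_uminus add.commute)
    finally show ?thesis ..
  qed
  then have "(\<integral>\<^sup>+k. emeasure lborel (P k) \<partial>count_space lattice)
      = (\<integral>\<^sup>+k. emeasure lborel (Q k) \<partial>count_space lattice)"
    by (intro nn_integral_cong) simp
  also have "\<dots> = emeasure lborel (E \<inter> V)"
  proof -
    \<comment> \<open>The roles are now exchanged: the pieces \<open>P k\<close> partition because
      each point has one representative in \<open>V\<close>, the pieces \<open>Q k\<close> because
      it has one in \<open>U\<close>.\<close>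
    have 1: "disjoint_family_on Q lattice"
      unfolding disjoint_family_on_def
    proof (intro ballI impI)
      fix k l :: "real^'n" assume kl: "k \<in> lattice" "l \<in> lattice" "k \<noteq> l"
      have False if "x \<in> Q k" "x \<in> Q l" for x
      proof -
        have "- k \<in> lattice \<and> x + - k \<in> U" "- l \<in> lattice \<and> x + - l \<in> U"
          using that kl lattice_minus by (auto simp: Q_def)
        then have "- k = - l" using U[of x] by blast
        then show False using kl by simp
      qed
      then show "Q k \<inter> Q l = {}" by blast
    qed
    have "\<exists>k\<in>lattice. x \<in> Q k" if "x \<in> E" "x \<in> V" for x
    proof -
      obtain l where "l \<in> lattice" "x + l \<in> U" using U by blast
      then show ?thesis using that lattice_minus[of l] by (intro bexI[of _ "- l"]) (auto simp: Q_def)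
    qed
    then have 2: "E \<inter> V = (\<Union>k\<in>lattice. Q k)"
      by (auto simp: Q_def)
    show ?thesis
      unfolding 2 using 1 countable_lattice by (subst emeasure_UN_countable) auto
  qed
  finally show ?thesis .
qed

lemma torus_ex1: "\<exists>!k. k \<in> lattice \<and> (x::real^'n) + k \<in> torus"
proof -
  obtain k where "k \<in> lattice" "tmod x = x + k"
    using tmod_lattice by blast
  moreover have "l = k" if "l \<in> lattice" "x + l \<in> torus" for l
    using that calculation by (metis tmod_add_lattice tmod_eq_self add_left_cancel)
  ultimately show ?thesis
    by (metis tmod_torus)
qed

text \<open>The shifted cube \<open>v + torus\<close> is another fundamental domain of the
  lattice.\<close>

lemma measure_torus_translate:
  fixes E :: "(real^'n) set"
  assumes [measurable]: "E \<in> sets borel"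
    and per: "\<And>x k. x \<in> E \<Longrightarrow> k \<in> lattice \<Longrightarrow> x + k \<in> E"
  shows "measure lborel (E \<inter> {x. x - v \<in> torus}) = measure lborel (E \<inter> torus)"
proof -
  have "\<exists>!k. k \<in> lattice \<and> x + k - v \<in> torus" for x
    using torus_ex1[of "x - v"] by (simp add: algebra_simps)
  then show ?thesis
    unfolding measure_def
    by (subst emeasure_fundamental_domain[OF _ _ torus_borel per _ torus_ex1]) auto
qed

text \<open>Invariance of Haar measure under rotation by \<open>v\<close>: translating by
  \<open>v\<close> turns the left-hand set into the part of \<open>E\<close> in the shifted
  cube.\<close>

lemma measure_torus_rotate:
  fixes E :: "(real^'n) set"
  assumes [measurable]: "E \<in> sets borel"
    and per: "\<And>x k. x \<in> E \<Longrightarrow> k \<in> lattice \<Longrightarrow> x + k \<in> E"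
  shows "measure lborel (torus \<inter> {y. y + v \<in> E}) = measure lborel (E \<inter> torus)"
proof -
  have "emeasure lborel (E \<inter> {x. x - v \<in> torus})
      = emeasure (distr lborel borel ((+) v)) (E \<inter> {x. x - v \<in> torus})"
    by (simp add: lborel_distr_plus)
  also have "\<dots> = emeasure lborel (((+) v) -` (E \<inter> {x. x - v \<in> torus}) \<inter> space lborel)"
    by (intro emeasure_distr) auto
  also have "((+) v) -` (E \<inter> {x. x - v \<in> torus}) \<inter> space lborel = torus \<inter> {y. y + v \<in> E}"
    by (auto simp: add.commute)
  finally show ?thesis
    using measure_torus_translate[OF assms, of v] by (simp add: measure_def)
qed

lemma emeasure_torus: "emeasure lborel (torus :: (real^'n) set) = 1"
proof (rule antisym)
  have *: "(\<Prod>b\<in>(Basis::(real^'n) set). (1::real^'n) \<bullet> b) = 1"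
    by (intro prod.neutral) (auto simp: Basis_vec_def inner_axis)
  have "emeasure lborel (torus :: (real^'n) set) \<le> emeasure lborel (cbox 0 (1::real^'n))"
    by (intro emeasure_mono) (auto simp: torus_def mem_box_cart less_imp_le)
  also have "\<dots> = 1"
    using * by (subst emeasure_lborel_cbox) (auto simp: Basis_vec_def inner_axis)
  finally show "emeasure lborel (torus :: (real^'n) set) \<le> 1" .
  have "1 = emeasure lborel (box 0 (1::real^'n))"
    using * by (subst emeasure_lborel_box) (auto simp: Basis_vec_def inner_axis)
  also have "\<dots> \<le> emeasure lborel (torus :: (real^'n) set)"
    by (intro emeasure_mono) (auto simp: torus_def mem_box_cart less_imp_le)
  finally show "1 \<le> emeasure lborel (torus :: (real^'n) set)" .
qed

lemma torus_fmeasurable: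
  assumes "E \<in> sets borel"
  shows "E \<inter> torus \<in> fmeasurable lborel"
proof (rule fmeasurableI2)
  show "torus \<in> fmeasurable lborel"
    by (rule fmeasurableI) (simp_all add: emeasure_torus)
qed (use assms in auto)

lemma measure_torus: "measure lborel (torus :: (real^'n) set) = 1"
  by (simp add: measure_def emeasure_torus)

text \<open>For radius at most 1/2 the ball fits into the unit cube centred at \<open>x\<close>, so
  it does not overlap its own lattice translates and has its Euclidean volume.\<close>

lemma measure_tball:
  fixes x :: "real^'n"
  assumes "0 < e" "e \<le> 1/2"
  shows "measure lborel (tnbhd {x} e \<inter> torus) = unit_ball_vol (real CARD('n)) * e ^ CARD('n)"
proof -
  \<comment> \<open>The lower corner of the unit cube centred at \<open>x\<close>.\<close>
  define v where "v = x - (\<chi> i. 1/2)"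
  have "tnbhd {x} e \<inter> {y. y - v \<in> torus} = ball x e"
  proof (intro set_eqI iffI)
    fix y assume "y \<in> tnbhd {x} e \<inter> {y. y - v \<in> torus}"
    then obtain k where k: "k \<in> lattice" "norm (x - y - k) < e" and y: "y - v \<in> torus"
      by (auto simp: tnbhd_def tdist_less_iff)
    have "k$i = 0" for i
    proof -
      \<comment> \<open>Since \<open>y\<close> lies in the cube centred at \<open>x\<close>,
        \<open>y$i - x$i\<close> is in [-1/2, 1/2). Together these force the integer
        \<open>k$i\<close> to have absolute value below 1.\<close>
      have "\<bar>x$i - y$i - k$i\<bar> < 1/2"
        using component_le_norm_cart[of "x - y - k" i] k assms by simp
      moreover have "(y - v)$i = y$i - x$i + 1/2"
        by (simp add: v_def)
      moreover have "0 \<le> (y - v)$i" "(y - v)$i < 1"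
        using y by (simp_all add: torus_def del: vector_minus_component)
      ultimately have "\<bar>k$i\<bar> < 1" by linarith
      moreover have "k$i \<in> \<int>"
        using k by (simp add: lattice_def)
      ultimately show ?thesis
        using Ints_nonzero_abs_less1[of "k$i"] by simp
    qed
    then have "k = 0" by (simp add: vec_eq_iff)
    then show "y \<in> ball x e" using k by (simp add: dist_norm)
  next
    fix y assume y: "y \<in> ball x e"
    have "0 \<le> (y - v)$i \<and> (y - v)$i < 1" for i
    proof -
      have "\<bar>x$i - y$i\<bar> < 1/2"
        using component_le_norm_cart[of "x - y" i] y assms by (simp add: dist_norm)
      moreover have "(y - v)$i = y$i - x$i + 1/2"
        by (simp add: v_def)
      ultimately show ?thesis by linarith
    qed
    then have "y - v \<in> torus"
      by (simp add: torus_def)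
    moreover have "tdist x y < e"
      using y tdist_le_norm[of x y] by (simp add: dist_norm)
    ultimately show "y \<in> tnbhd {x} e \<inter> {y. y - v \<in> torus}"
      by (simp add: tnbhd_def)
  qed
  then have "measure lborel (ball x e) = measure lborel (tnbhd {x} e \<inter> torus)"
    using measure_torus_translate[OF tnbhd_borel tnbhd_lattice, of "{x}" e v] by simp
  then show ?thesis
    using content_ball[of e x] assms by simp
qed

section \<open>Packings\<close>

definition packing :: "(real^'n) set \<Rightarrow> real \<Rightarrow> (real^'n) set \<Rightarrow> bool" where
  "packing S e F \<longleftrightarrow> finite F \<and> F \<subseteq> S \<and> (\<forall>x\<in>F. \<forall>y\<in>F. x \<noteq> y \<longrightarrow> tdist x y \<ge> 2 * e)"

lemma tnbhd_UN: "tnbhd F e = (\<Union>x\<in>F. tnbhd {x} e)"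
  by (auto simp: tnbhd_def)

text \<open>Open balls of radius \<open>e\<close> around points at mutual distance at least
  \<open>2 * e\<close> are disjoint, so their volumes add up.\<close>

lemma measure_tnbhd_packing:
  fixes F :: "(real^'n) set"
  assumes F: "packing S e F" and e: "0 < e" "e \<le> 1/2"
  shows "measure lborel (tnbhd F e \<inter> torus)
    = real (card F) * (unit_ball_vol (real CARD('n)) * e ^ CARD('n))"
proof -
  have "disjnt (tnbhd {x} e \<inter> torus) (tnbhd {y} e \<inter> torus)" if "x \<in> F" "y \<in> F" "x \<noteq> y" for x y
  proof -
    have False if "tdist x z < e" "tdist y z < e" for z
    proof -
      have "tdist x y < e + e"
        using tdist_triangle_less[of x z e y e] that by (simp add: tdist_commute)
      moreover have "2 * e \<le> tdist x y"
        using F \<open>x \<in> F\<close> \<open>y \<in> F\<close> \<open>x \<noteq> y\<close> by (simp add: packing_def)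
      ultimately show False by simp
    qed
    then show ?thesis by (auto simp: disjnt_def tnbhd_def)
  qed
  then have "measure lborel (\<Union>x\<in>F. tnbhd {x} e \<inter> torus)
      = (\<Sum>x\<in>F. measure lborel (tnbhd {x} e \<inter> torus))"
    using F by (intro measure_UNION') (auto simp: packing_def pairwise_def torus_fmeasurable)
  also have "\<dots> = (\<Sum>x\<in>F. unit_ball_vol (real CARD('n)) * e ^ CARD('n))"
    using measure_tball[OF e, where 'n='n] by simp
  also have "(\<Union>x\<in>F. tnbhd {x} e \<inter> torus) = tnbhd F e \<inter> torus"
    by (subst tnbhd_UN) auto
  finally show ?thesis by simp
qed

lemma measure_subset_torus_le_1:
  assumes "E \<in> sets borel"
  shows "measure lborel (E \<inter> torus :: (real^'n) set) \<le> 1"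
proof -
  have "measure lborel (E \<inter> torus) \<le> measure lborel (torus :: (real^'n) set)"
    using assms torus_fmeasurable[of UNIV] by (intro measure_mono_fmeasurable) auto
  then show ?thesis by (simp add: measure_torus)
qed

lemma card_packing_le:
  fixes F :: "(real^'n) set"
  assumes "packing S e F" and e: "0 < e" "e \<le> 1/2"
  shows "real (card F) \<le> 1 / unit_ball_vol (real CARD('n)) * e powr (- real CARD('n))"
proof -
  have "real (card F) * (unit_ball_vol (real CARD('n)) * e ^ CARD('n)) \<le> 1"
    using measure_tnbhd_packing[OF assms] measure_subset_torus_le_1[OF tnbhd_borel, of F e] by simp
  then show ?thesis
    using e by (simp add: powr_minus powr_realpow field_simps)
qed

text \<open>\<open>Sup\<close> of a set of naturals carries information only if the set is bounded.
  The volume bound makes the set of packing sizes finite, and the empty packing makes it nonempty,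
  so the supremum is a maximum.\<close>

lemma packing_number_attained:
  fixes S :: "(real^'n) set"
  assumes e: "0 < e" "e \<le> 1/2"
  obtains F where "packing S e F" "packing_number S e = card F"
    "\<And>G. packing S e G \<Longrightarrow> card G \<le> card F"
proof -
  define X where "X = {card F | F. packing S e F}"
  have "X \<subseteq> {..nat \<lfloor>1 / unit_ball_vol (real CARD('n)) * e powr (- real CARD('n))\<rfloor>}"
    using card_packing_le[OF _ e] by (auto simp: X_def intro!: le_nat_floor)
  then have fin: "finite X"
    by (rule finite_subset) simp
  have "packing S e {}" by (simp add: packing_def)
  then have "X \<noteq> {}" by (auto simp: X_def)
  have "packing_number S e = Sup X"
    by (simp add: packing_number_def X_def packing_def)
  also have "\<dots> = Max X"
    using fin \<open>X \<noteq> {}\<close> by (rule cSup_eq_Max)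
  finally have "packing_number S e = Max X" .
  moreover have "Max X \<in> X"
    using fin \<open>X \<noteq> {}\<close> by (rule Max_in)
  ultimately obtain F where F: "packing S e F" "packing_number S e = card F" "card F = Max X"
    by (auto simp: X_def)
  moreover have "card G \<le> card F" if "packing S e G" for G
    using F(3) fin that by (auto simp: X_def intro!: Max_ge)
  ultimately show thesis using that by blast
qed

lemma packing_number_le:
  fixes S :: "(real^'n) set"
  assumes "0 < e" "e \<le> 1/2"
  shows "real (packing_number S e) \<le> 1 / unit_ball_vol (real CARD('n)) * e powr (- real CARD('n))"
  using packing_number_attained[OF assms, of S] card_packing_le[OF _ assms] by metis

text \<open>A packing of maximal size is a \<open>2e\<close>-net.\<close>

lemma measure_tnbhd_le:
  fixes S :: "(real^'n) set"
  assumes e: "0 < e" "e \<le> 1/6"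
  shows "measure lborel (tnbhd S e \<inter> torus)
    \<le> real (packing_number S e) * (unit_ball_vol (real CARD('n)) * (3 * e) ^ CARD('n))"
proof -
  obtain F where F: "packing S e F" "packing_number S e = card F"
    and max: "\<And>G. packing S e G \<Longrightarrow> card G \<le> card F"
    using packing_number_attained[of e S] e by auto
  have fin: "finite F" using F by (simp add: packing_def)
  \<comment> \<open>A point of \<open>S\<close> far from all of \<open>F\<close> could be added to
    \<open>F\<close>, against maximality.\<close>
  have net: "\<exists>x\<in>F. tdist x b < 2 * e" if "b \<in> S" for b
  proof (rule ccontr)
    assume "\<not> ?thesis"
    then have far: "2 * e \<le> tdist x b" "2 * e \<le> tdist b x" if "x \<in> F" for x
      using that by (auto simp: not_less tdist_commute)
    have "b \<notin> F"
      using far(1)[of b] tdist_le_norm[of b b] e by auto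
    moreover have "packing S e (insert b F)"
      using F(1) far \<open>b \<in> S\<close> by (auto simp: packing_def)
    ultimately show False
      using max[of "insert b F"] fin by simp
  qed
  have "tnbhd S e \<inter> torus \<subseteq> (\<Union>x\<in>F. tnbhd {x} (3 * e) \<inter> torus)"
  proof
    fix y assume y: "y \<in> tnbhd S e \<inter> torus"
    then obtain b where b: "b \<in> S" "tdist b y < e" by (auto simp: tnbhd_def)
    then obtain x where "x \<in> F" "tdist x b < 2 * e" using net by blast
    then show "y \<in> (\<Union>x\<in>F. tnbhd {x} (3 * e) \<inter> torus)"
      using y tdist_triangle_less[OF _ b(2), of x "2 * e"] by (auto simp: tnbhd_def)
  qed
  then have "measure lborel (tnbhd S e \<inter> torus) \<le> measure lborel (\<Union>x\<in>F. tnbhd {x} (3 * e) \<inter> torus)"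
    using fin by (intro measure_mono_fmeasurable fmeasurable.finite_UN) (auto intro!: torus_fmeasurable)
  also have "\<dots> \<le> (\<Sum>x\<in>F. measure lborel (tnbhd {x} (3 * e) \<inter> torus))"
    using fin by (intro measure_UNION_le) auto
  also have "\<dots> = real (card F) * (unit_ball_vol (real CARD('n)) * (3 * e) ^ CARD('n))"
    using measure_tball[of "3 * e", where 'n='n] e by simp
  finally show ?thesis using F by simp
qed

section \<open>The neighbourhood of a closed set\<close>

lemma tclosed_borel:
  assumes "tclosed A"
  shows "A \<in> sets borel"
proof -
  have "A = {x. tmod x \<in> A} \<inter> torus"
    using assms by (auto simp: tclosed_def tmod_eq_self)
  moreover have "{x. tmod x \<in> A} \<inter> torus \<in> sets borel"
    using assms by (auto simp: tclosed_def)
  ultimately show ?thesis by simp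
qed

text \<open>A segment from a point outside \<open>A\<close> to a nearby point of \<open>A\<close>
  must cross the boundary. The argument runs in the vector space, with \<open>T\<close> the periodic
  lift of \<open>A\<close>, and is then projected by \<open>tmod\<close>.\<close>

lemma tnbhd_subset_boundary:
  fixes A :: "(real^'n) set"
  assumes "A \<subseteq> torus"
  shows "tnbhd A e \<inter> torus \<subseteq> A \<union> (tnbhd (tboundary A) e \<inter> torus)"
proof
  fix y assume "y \<in> tnbhd A e \<inter> torus"
  then obtain a where a: "a \<in> A" "tdist a y < e" and y: "y \<in> torus"
    by (auto simp: tnbhd_def)
  show "y \<in> A \<union> (tnbhd (tboundary A) e \<inter> torus)"
  proof (cases "y \<in> A")
    case False
    define T where "T = {x. tmod x \<in> A}"
    obtain k where k: "k \<in> lattice" "norm (a - y - k) < e"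
      using a unfolding tdist_less_iff by blast
    have "tmod (a - k) = a"
      using tmod_add_lattice[OF lattice_minus[OF k(1)], of a] tmod_eq_self assms a by auto
    then have "a - k \<in> T" using a by (simp add: T_def)
    moreover have "y \<notin> T" using False y by (simp add: T_def tmod_eq_self)
    \<comment> \<open>\<open>a - k\<close> is the lift of \<open>a\<close> close to
      \<open>y\<close>. The crossing point \<open>z\<close> is no farther from \<open>y\<close> than
      \<open>a - k\<close> is, hence within \<open>e\<close>.\<close>
    ultimately have "closed_segment y (a - k) \<inter> frontier T \<noteq> {}"
      by (intro connected_Int_frontier) auto
    then obtain z where z: "z \<in> closed_segment y (a - k)" "z \<in> frontier T" by blast
    have "tmod z \<in> tboundary A"
      unfolding tboundary_def
    proof (intro CollectI conjI allI impI tmod_torus)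
      fix d :: real assume "0 < d"
      then obtain u v where u: "u \<in> T" "dist z u < d" and v: "v \<notin> T" "dist z v < d"
        using z(2) unfolding frontier_straddle by blast
      have "tdist (tmod z) (tmod w) < d" if "dist z w < d" for w
      proof -
        have "tdist (tmod z) (tmod w) = tdist z w"
          by (metis tdist_commute tdist_tmod_left)
        also have "\<dots> < d"
          using that tdist_le_norm[of z w] by (simp add: dist_norm)
        finally show ?thesis .
      qed
      then have "tdist (tmod z) (tmod u) < d" "tdist (tmod z) (tmod v) < d"
        using u v by blast+
      moreover have "tmod u \<in> A" "tmod v \<in> torus - A"
        using u v by (simp_all add: T_def)
      ultimately show "\<exists>y\<in>A. tdist (tmod z) y < d" "\<exists>y\<in>torus - A. tdist (tmod z) y < d"
        by blast+
    qed
    moreover have "tdist (tmod z) y < e"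
    proof -
      have "tdist (tmod z) y \<le> norm (z - y)"
        by (simp add: tdist_tmod_left tdist_le_norm)
      also have "\<dots> \<le> norm (a - k - y)"
        using segment_bound1[OF z(1)] by simp
      also have "a - k - y = a - y - k" by simp
      finally show ?thesis using k by simp
    qed
    ultimately show ?thesis using y by (auto simp: tnbhd_def)
  qed simp
qed

lemma measure_tnbhd_closed:
  fixes A :: "(real^'n) set"
  assumes "tclosed A" "0 < e" "e \<le> 1/6"
  shows "measure lborel (tnbhd A e \<inter> torus) \<le> tmu A
    + real (packing_number (tboundary A) e) * (unit_ball_vol (real CARD('n)) * (3 * e) ^ CARD('n))"
proof -
  have A: "A \<subseteq> torus" using assms by (simp add: tclosed_def)
  note [measurable] = tclosed_borel[OF assms(1)]
  have "A = A \<inter> torus" using A by blast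
  then have fA: "A \<in> fmeasurable lborel"
    using torus_fmeasurable[of A] by simp
  have "measure lborel (tnbhd A e \<inter> torus) \<le> measure lborel (A \<union> (tnbhd (tboundary A) e \<inter> torus))"
    using tnbhd_subset_boundary[OF A] fA
    by (intro measure_mono_fmeasurable fmeasurable.Un) (auto intro!: torus_fmeasurable)
  also have "\<dots> \<le> measure lborel A + measure lborel (tnbhd (tboundary A) e \<inter> torus)"
    by (intro measure_Un_le) auto
  also have "measure lborel A = tmu A"
    by (simp add: tmu_def measure_completion)
  finally show ?thesis
    using measure_tnbhd_le[OF assms(2,3), of "tboundary A"] by simp
qed

section \<open>Dense orbits\<close>

text \<open>This is linear independence over the rationals of 1 and the coordinates of \<alpha>. In
  this form the exceptional set is visibly a countable union of hyperplanes.\<close>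

definition generic :: "real^'n \<Rightarrow> bool" where
  "generic \<alpha> \<longleftrightarrow> (\<forall>a\<in>lattice. a \<noteq> 0 \<longrightarrow> a \<bullet> \<alpha> \<notin> \<int>)"

lemma AE_generic: "AE \<alpha> in lebesgue_on torus. generic (\<alpha> :: real^'n)"
proof -
  have cI: "countable (\<int> :: real set)"
    by (simp add: Ints_def)
  have "negligible (\<Union>a\<in>lattice - {0::real^'n}. \<Union>b\<in>\<int>. {x. a \<bullet> x = b})"
    unfolding negligible_iff_null_sets
    using cI countable_lattice countable_subset[of "lattice - {0::real^'n}" lattice]
    by (intro null_sets_UN') (auto simp flip: negligible_iff_null_sets intro: negligible_hyperplane)
  then have "AE x in lebesgue. x \<notin> (\<Union>a\<in>lattice - {0::real^'n}. \<Union>b\<in>\<int>. {x. a \<bullet> x = b})"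
    unfolding negligible_iff_null_sets by (rule AE_not_in)
  then have "AE x in lebesgue. generic (x::real^'n)"
    by eventually_elim (auto simp: generic_def)
  then show ?thesis
    using sets_completionI_sets[of torus lborel] torus_borel
    by (subst AE_restrict_space_iff) auto
qed

text \<open>The form of genericity that Kronecker's theorem asks for. Independence of a set does not
  see repetitions, so distinctness of the coordinates and of 1 is recorded separately; the vectors
  \<open>axis i 1 - axis j 1\<close> and \<open>axis i 1\<close> give it.\<close>

lemma generic_independent:
  fixes \<alpha> :: "real^'n"
  assumes "generic \<alpha>"
  shows "inj (($) \<alpha>)" and "1 \<notin> range (($) \<alpha>)"
    and "module.independent (\<lambda>r x. real_of_int r * x) (insert 1 (range (($) \<alpha>)))"
proof -
  have axl: "axis i 1 \<in> lattice" for i :: 'n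
    by (simp add: lattice_def axis_def)
  show inj: "inj (($) \<alpha>)"
  proof (rule injI, rule ccontr)
    fix i j assume eq: "\<alpha>$i = \<alpha>$j" and "i \<noteq> j"
    then have "axis i 1 - axis j 1 \<noteq> (0::real^'n)"
      by (simp add: axis_eq_axis)
    moreover have "(axis i 1 - axis j 1) \<bullet> \<alpha> = 0"
      using eq by (simp add: inner_diff_left inner_axis' )
    ultimately show False
      using assms lattice_diff[OF axl axl, of i j] unfolding generic_def by fastforce
  qed
  show not1: "1 \<notin> range (($) \<alpha>)"
  proof
    assume "1 \<in> range (($) \<alpha>)"
    then obtain i where "\<alpha>$i = 1" by auto
    then have "axis i 1 \<bullet> \<alpha> = 1" by (simp add: inner_axis')
    moreover have "axis i 1 \<noteq> (0::real^'n)" by (simp add: axis_eq_0_iff)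
    ultimately show False
      using assms axl[of i] unfolding generic_def by fastforce
  qed
  interpret Modules.module "(\<lambda>r. (*) (real_of_int r))"
    by (simp add: Modules.module.intro distrib_left mult.commute)
  show "independent (insert 1 (range (($) \<alpha>)))"
    unfolding independent_explicit_module
  proof (intro allI impI)
    fix t u and v :: real
    assume t: "finite t" "t \<subseteq> insert 1 (range (($) \<alpha>))" and 0: "(\<Sum>v\<in>t. real_of_int (u v) * v) = 0"
      and v: "v \<in> t"
    \<comment> \<open>The coefficient vector of the given integer relation. The relation makes
      \<open>a \<bullet> \<alpha>\<close> an integer, so genericity forces \<open>a = 0\<close>,
      after which the coefficient of 1 vanishes too.\<close>
    define a :: "real^'n" where "a = (\<chi> i. if \<alpha>$i \<in> t then of_int (u (\<alpha>$i)) else 0)"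
    have al: "a \<in> lattice" by (simp add: a_def lattice_def)
    have "a \<bullet> \<alpha> = (\<Sum>i\<in>UNIV. (if \<alpha>$i \<in> t then of_int (u (\<alpha>$i)) * \<alpha>$i else 0))"
      by (simp add: inner_vec_def a_def if_distrib[of "\<lambda>x. x * _"] cong: if_cong)
    also have "\<dots> = (\<Sum>i\<in>{i. \<alpha>$i \<in> t}. of_int (u (\<alpha>$i)) * \<alpha>$i)"
      by (intro sum.mono_neutral_cong_right) auto
    also have "\<dots> = (\<Sum>v\<in>(($) \<alpha>) ` {i. \<alpha>$i \<in> t}. real_of_int (u v) * v)"
      using inj by (subst sum.reindex) (auto simp: inj_on_def)
    also have "(($) \<alpha>) ` {i. \<alpha>$i \<in> t} = t - {1}"
      using t not1 by force
    finally have "a \<bullet> \<alpha> = (\<Sum>v\<in>t - {1}. real_of_int (u v) * v)" .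
    moreover have "(\<Sum>v\<in>t. real_of_int (u v) * v)
        = (\<Sum>v\<in>t - {1}. real_of_int (u v) * v) + (if 1 \<in> t then real_of_int (u 1) else 0)"
      using t(1) by (simp add: sum.remove)
    ultimately have a1: "a \<bullet> \<alpha> = - (if 1 \<in> t then real_of_int (u 1) else 0)"
      using 0 by simp
    then have "a \<bullet> \<alpha> \<in> \<int>" by auto
    then have "a = 0" using assms al unfolding generic_def by blast
    show "u v = 0"
    proof (cases "v = 1")
      case True
      then show ?thesis using a1 \<open>a = 0\<close> v by simp
    next
      case False
      then obtain i where i: "v = \<alpha>$i" using v t by blast
      have "a$i = 0" using \<open>a = 0\<close> by simp
      then show ?thesis using v i by (simp add: a_def)
    qed
  qed
qed

lemma generic_dense:
  fixes \<alpha> y :: "real^'n"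
  assumes "generic \<alpha>" "e > 0"
  shows "\<exists>k::int. tdist (of_int k *\<^sub>R \<alpha>) y < e"
proof -
  define n where "n = CARD('n)"
  obtain f where f: "bij_betw f {..<n} (UNIV :: 'n set)"
    using ex_bij_betw_nat_finite[of "UNIV :: 'n set"] by (auto simp: n_def atLeast0LessThan)
  \<comment> \<open>The coordinates of \<alpha> in some order, followed by 1 at position
    \<open>n\<close>, which is how \<open>Kronecker_thm_2\<close> expects them. The tolerance
    \<open>e / real n\<close> used below makes the sum of the \<open>n\<close> coordinate errors
    less than \<open>e\<close>.\<close>
  define \<theta> where "\<theta> i = (if i < n then \<alpha>$(f i) else 1)" for i
  have "\<theta> ` {..<n} = (($) \<alpha>) ` (f ` {..<n})"
    by (auto simp: \<theta>_def image_image)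
  also have "\<dots> = range (($) \<alpha>)"
    using f by (simp add: bij_betw_def)
  finally have img: "\<theta> ` {..<n} = range (($) \<alpha>)" .
  have ins: "{..n} = insert n {..<n}" by auto
  have img': "\<theta> ` {..n} = insert 1 (range (($) \<alpha>))"
    unfolding ins image_insert img by (simp add: \<theta>_def)
  have "inj_on \<theta> {..<n} = inj_on (($) \<alpha> \<circ> f) {..<n}"
    by (intro inj_on_cong) (simp add: \<theta>_def)
  moreover have "inj_on (($) \<alpha> \<circ> f) {..<n}"
    using f generic_independent(1)[OF assms(1)]
    by (intro comp_inj_on) (auto simp: bij_betw_def intro: inj_on_subset)
  ultimately have "inj_on \<theta> {..n}"
    unfolding ins using img generic_independent(2)[OF assms(1)]
    by (simp add: \<theta>_def)
  moreover have "module.independent (\<lambda>r x. real_of_int r * x) (\<theta> ` {..n})"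
    unfolding img' using generic_independent(3)[OF assms(1)] .
  moreover have "e / real n > 0" "\<theta> n = 1"
    using assms by (simp_all add: n_def \<theta>_def)
  ultimately obtain k m
    where km: "\<And>i. i < n \<Longrightarrow> \<bar>of_int k * \<theta> i - of_int (m i) - y$(f i)\<bar> < e / real n"
    using Kronecker_thm_2[of \<theta> n "e / real n" "\<lambda>i. y$(f i)"] by blast
  define l :: "real^'n" where "l = (\<chi> i. of_int (m (the_inv_into {..<n} f i)))"
  have "l \<in> lattice" by (simp add: l_def lattice_def)
  moreover have "norm (of_int k *\<^sub>R \<alpha> - y - l) < e"
  proof -
    have "\<bar>(of_int k *\<^sub>R \<alpha> - y - l)$j\<bar> < e / real n" for j
    proof -
      obtain i where i: "i < n" "j = f i"
        using f unfolding bij_betw_def by blast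
      have "the_inv_into {..<n} f j = i"
        using f i by (simp add: bij_betw_def the_inv_into_f_f)
      then show ?thesis
        using km[OF i(1)] i by (simp add: l_def \<theta>_def algebra_simps)
    qed
    then have "(\<Sum>j\<in>UNIV. \<bar>(of_int k *\<^sub>R \<alpha> - y - l)$j\<bar>) < (\<Sum>j\<in>(UNIV::'n set). e / real n)"
      by (intro sum_strict_mono) auto
    also have "\<dots> = e" by (simp add: n_def)
    finally show ?thesis
      using norm_le_l1_cart[of "of_int k *\<^sub>R \<alpha> - y - l"] by linarith
  qed
  ultimately show ?thesis unfolding tdist_less_iff by blast
qed

text \<open>Two-sided orbits are dense, so the sets \<open>U k\<close> cover the compact unit cube
  and finitely many integer times suffice. The resulting \<open>L\<close> does not depend on the
  starting point \<open>y\<close>.\<close>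

lemma generic_uniform_hitting:
  fixes \<alpha> x :: "real^'n"
  assumes "generic \<alpha>" "e > 0"
  obtains L :: nat where "\<And>y. \<exists>i\<le>L. y + real i *\<^sub>R \<alpha> \<in> tnbhd {x} e"
proof -
  define U where "U k = {y. y + of_int k *\<^sub>R \<alpha> \<in> tnbhd {x} e}" for k :: int
  have "open (U k)" for k
  proof -
    have "U k = (\<lambda>y. y + of_int k *\<^sub>R \<alpha>) -` tnbhd {x} e"
      by (auto simp: U_def)
    then show ?thesis
      by (simp add: open_tnbhd open_vimage continuous_intros)
  qed
  moreover have "cbox 0 1 \<subseteq> (\<Union>k\<in>UNIV. U k)"
  proof
    fix y :: "real^'n"
    obtain k :: int where "tdist (of_int k *\<^sub>R \<alpha>) (x - y) < e"
      using generic_dense[OF assms] by blast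
    then have "tdist x (y + of_int k *\<^sub>R \<alpha>) < e"
      using tdist_add_right[of "of_int k *\<^sub>R \<alpha>" y "x - y"] by (simp add: tdist_commute add.commute)
    then show "y \<in> (\<Union>k\<in>UNIV. U k)" by (auto simp: U_def tnbhd_def)
  qed
  ultimately obtain D where D: "finite D" "cbox 0 1 \<subseteq> (\<Union>k\<in>D. U k)"
    using compactE_image[OF compact_cbox, of UNIV U] by metis
  define K where "K = nat (Max (insert 0 (abs ` D)))"
  have K: "\<bar>k\<bar> \<le> int K" if "k \<in> D" for k
    using that D(1) by (auto simp: K_def intro!: Max_ge)
  show thesis
  proof
    fix y
    \<comment> \<open>Starting from time \<open>K\<close> turns the possibly negative time
      \<open>k\<close> into \<open>K + k\<close>, which lies between 0 and
      \<open>2 * K\<close>.\<close>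
    define z where "z = y + real K *\<^sub>R \<alpha>"
    have "tmod z \<in> cbox 0 1"
      using tmod_torus[of z] by (auto simp: torus_def mem_box_cart less_imp_le simp del: tmod_torus)
    then obtain k where k: "k \<in> D" "tmod z \<in> U k" using D by blast
    obtain l where l: "l \<in> lattice" "tmod z = z + l" using tmod_lattice by blast
    have "z + l + of_int k *\<^sub>R \<alpha> \<in> tnbhd {x} e"
      using k l by (simp add: U_def)
    then have "z + l + of_int k *\<^sub>R \<alpha> + (- l) \<in> tnbhd {x} e"
      using lattice_minus[OF l(1)] by (rule tnbhd_lattice)
    moreover have "real (nat (int K + k)) = real K + of_int k"
      using K[OF k(1)] by simp
    ultimately have "y + real (nat (int K + k)) *\<^sub>R \<alpha> \<in> tnbhd {x} e"
      by (simp add: z_def algebra_simps)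
    then show "\<exists>i\<le>2 * K. y + real i *\<^sub>R \<alpha> \<in> tnbhd {x} e"
      using K[OF k(1)] by (intro exI[of _ "nat (int K + k)"]) auto
  qed
qed

section \<open>Ergodic sums along visits to a heavy set\<close>

text \<open>Cut the interval at the visits to \<open>B\<close>. Each block runs from one visit to
  the next, or to \<open>M\<close> for the last one, and contributes at least \<open>d\<close> by
  the hypothesis at its left end.\<close>

lemma sum_ge_visits_from:
  fixes a :: "nat \<Rightarrow> real" and B :: "nat set"
  assumes heavy: "\<And>s n. s \<in> B \<Longrightarrow> n \<ge> 1 \<Longrightarrow> d \<le> (\<Sum>i = s..<s + n. a i)"
    and "s \<in> B" "s < M"
  shows "d * real (card (B \<inter> {s..<M})) \<le> (\<Sum>i = s..<M. a i)"
  using assms(2,3)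
proof (induction "M - s" arbitrary: s rule: less_induct)
  case less
  define C where "C = B \<inter> {Suc s..<M}"
  have "B \<inter> {s..<M} = insert s C"
    using less.prems by (auto simp: C_def)
  then have card: "card (B \<inter> {s..<M}) = Suc (card C)"
    by (simp add: C_def)
  show ?case
  proof (cases "C = {}")
    case True
    then show ?thesis
      using heavy[OF less.prems(1), of "M - s"] less.prems card by simp
  next
    case False
    define t where "t = Min C"
    have fin: "finite C" by (simp add: C_def)
    have "t \<in> C" using False fin by (simp add: t_def)
    then have t: "t \<in> B" "s < t" "t < M" by (auto simp: C_def)
    have "C = B \<inter> {t..<M}"
      using t fin by (auto simp: C_def t_def)
    then have "d * real (card C) \<le> (\<Sum>i = t..<M. a i)"
      using less.hyps[of t] t by simp
    moreover have "d \<le> (\<Sum>i = s..<t. a i)"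
      using heavy[OF less.prems(1), of "t - s"] t by simp
    moreover have "(\<Sum>i = s..<t. a i) + (\<Sum>i = t..<M. a i) = (\<Sum>i = s..<M. a i)"
      using t by (simp add: sum.atLeastLessThan_concat)
    ultimately show ?thesis
      unfolding card by (simp add: algebra_simps)
  qed
qed

text \<open>Only the terms before the first visit escape the block argument. There are at most
  \<open>L\<close> of them, each at least -1, whence the error \<open>real L\<close>, which is
  independent of \<open>M\<close>.\<close>

lemma sum_ge_visits:
  fixes a :: "nat \<Rightarrow> real" and B :: "nat set"
  assumes heavy: "\<And>s n. s \<in> B \<Longrightarrow> n \<ge> 1 \<Longrightarrow> d \<le> (\<Sum>i = s..<s + n. a i)"
    and low: "\<And>i. -1 \<le> a i" and hit: "l \<in> B" "l \<le> L"
  shows "d * (\<Sum>i<M. indicator B i) \<le> (\<Sum>i<M. a i) + real L"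
proof -
  define t where "t = (LEAST t. t \<in> B)"
  have t: "t \<in> B" "t \<le> L" and least: "\<And>s. s \<in> B \<Longrightarrow> t \<le> s"
    using hit LeastI[of "\<lambda>t. t \<in> B" l] Least_le[of "\<lambda>t. t \<in> B"]
    by (auto simp: t_def intro: order_trans)
  have lowsum: "- real n \<le> (\<Sum>i<n. a i)" for n
    using sum_mono[of "{..<n}" "\<lambda>_. -1" a] low by simp
  have ind: "(\<Sum>i<M. indicator B i) = real (card (B \<inter> {..<M}))"
    by (simp add: indicator_def sum.If_cases Int_commute)
  show ?thesis
  proof (cases "M \<le> t")
    case True
    then have "B \<inter> {..<M} = {}" using least by fastforce
    then show ?thesis
      unfolding ind using lowsum[of M] True t(2) by simp
  next
    case False
    have "B \<inter> {..<M} = B \<inter> {t..<M}" using least by auto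
    then have "d * real (card (B \<inter> {..<M})) \<le> (\<Sum>i = t..<M. a i)"
      using sum_ge_visits_from[OF heavy t(1), of M] False by simp
    moreover have "(\<Sum>i<t. a i) + (\<Sum>i = t..<M. a i) = (\<Sum>i<M. a i)"
      using False by (simp add: lessThan_atLeast0 sum.atLeastLessThan_concat)
    ultimately show ?thesis
      unfolding ind using lowsum[of t] t(2) by linarith
  qed
qed

text \<open>The orbits of \<open>x\<close> and \<open>y\<close> stay within \<open>e\<close> of each
  other, so each visit of the first to \<open>A\<close> is a visit of the second to
  \<open>tnbhd A e\<close>. The gain from positivity to \<open>1 / real q\<close> is
  integrality.\<close>

lemma heavy_nbhd_sum_ge:
  fixes A :: "(real^'n) set"
  assumes F: "F \<subseteq> heavy A \<alpha>" and y: "y \<in> tnbhd F e"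
    and pq: "0 < q" "of_int p / real q \<le> tmu A" and n: "n \<ge> 1"
  shows "1 / real q \<le> (\<Sum>i<n. indicator (tnbhd A e) (y + real i *\<^sub>R \<alpha>) - of_int p / real q)"
proof -
  obtain x where x: "x \<in> heavy A \<alpha>" "tdist x y < e"
    using F y by (auto simp: tnbhd_def)
  define N where "N = card {i\<in>{..<n}. y + real i *\<^sub>R \<alpha> \<in> tnbhd A e}"
  have N: "(\<Sum>i<n. indicator (tnbhd A e) (y + real i *\<^sub>R \<alpha>)) = real N"
    by (simp add: N_def indicator_def sum.If_cases Collect_conj_eq lessThan_def)
  have "indicator A (tmod (x + real i *\<^sub>R \<alpha>)) \<le> (indicator (tnbhd A e) (y + real i *\<^sub>R \<alpha>) :: real)" for i
  proof -
    have "tdist (tmod (x + real i *\<^sub>R \<alpha>)) (y + real i *\<^sub>R \<alpha>) < e"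
      using x by (simp add: tdist_tmod_left tdist_add_right)
    then show ?thesis
      by (auto simp: indicator_def tnbhd_def)
  qed
  then have "(\<Sum>i<n. indicator A (tmod (x + real i *\<^sub>R \<alpha>))) \<le> real N"
    unfolding N[symmetric] by (intro sum_mono) auto
  moreover have "(\<Sum>i<n. indicator A (tmod (x + real i *\<^sub>R \<alpha>)) - tmu A) > 0"
    using x n unfolding heavy_def by blast
  then have "real n * tmu A < (\<Sum>i<n. indicator A (tmod (x + real i *\<^sub>R \<alpha>)))"
    by (simp add: sum_subtractf)
  moreover have "real n * (of_int p / real q) \<le> real n * tmu A"
    using pq by (intro mult_left_mono) auto
  ultimately have "real n * (of_int p / real q) < real N"
    by linarith
  then have "of_int (int n * p) < (of_int (int N * int q) :: real)"
    \<comment> \<open>After multiplication by \<open>q\<close> both sides are integers, so the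
      strict inequality improves by 1.\<close>
    using pq by (simp add: field_simps)
  then have "int n * p + 1 \<le> int N * int q"
    by linarith
  then have "of_int (int n * p + 1) \<le> (of_int (int N * int q) :: real)"
    by (simp only: of_int_le_iff)
  then have "1 / real q \<le> real N - real n * (of_int p / real q)"
    using pq by (simp add: field_simps)
  then show ?thesis
    unfolding sum_subtractf N by simp
qed

text \<open>Integrate the previous bound over the torus and divide by the length \<open>M\<close> of the orbit.\<close>

lemma measure_heavy_nbhd_le:
  fixes A :: "(real^'n) set"
  assumes F: "F \<subseteq> heavy A \<alpha>" "x \<in> F" and e: "e > 0" and \<alpha>: "generic \<alpha>"
    and pq: "0 < q" "of_int p / real q \<le> tmu A" and mu: "tmu A \<le> 1"
  shows "measure lborel (tnbhd F e \<inter> torus)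
    \<le> real q * (measure lborel (tnbhd A e \<inter> torus) - of_int p / real q)"
proof -
  define r where "r = of_int p / real q"
  define E1 where "E1 = tnbhd A e"
  define E2 where "E2 = tnbhd F e"
  define m1 where "m1 = measure lborel (E1 \<inter> torus)"
  define m2 where "m2 = measure lborel (E2 \<inter> torus)"
  \<comment> \<open>The points of the torus whose orbit is in \<open>E\<close> at time
    \<open>i\<close>; for periodic \<open>E\<close> the measure does not depend on
    \<open>i\<close>.\<close>
  define J where "J E i = torus \<inter> {y. y + real i *\<^sub>R \<alpha> \<in> E}" for E i
  have [measurable]: "E1 \<in> sets borel" "E2 \<in> sets borel"
    by (simp_all add: E1_def E2_def)
  have J: "J E i \<in> fmeasurable lborel" if [measurable]: "E \<in> sets borel" for E i
    using torus_fmeasurable[of "{y. y + real i *\<^sub>R \<alpha> \<in> E}"] by (simp add: J_def Int_commute)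
  have mJ: "measure lborel (J E1 i) = m1" "measure lborel (J E2 i) = m2" for i
    unfolding J_def m1_def m2_def
    by (intro measure_torus_rotate; simp add: E1_def E2_def tnbhd_lattice)+
  obtain L where L: "\<And>y. \<exists>i\<le>L. y + real i *\<^sub>R \<alpha> \<in> tnbhd {x} e"
    using generic_uniform_hitting[OF \<alpha> e] by blast
  have pointwise: "1 / real q * (\<Sum>i<M. indicator (J E2 i) y)
      \<le> (\<Sum>i<M. indicator (J E1 i) y - r * indicator torus y) + real L * indicator torus y" for M y
  proof (cases "y \<in> torus")
    case True
    define B where "B = {i. y + real i *\<^sub>R \<alpha> \<in> E2}"
    define a where "a i = indicator E1 (y + real i *\<^sub>R \<alpha>) - r" for i :: nat
    have "1 / real q \<le> (\<Sum>i = s..<s + n. a i)" if "s \<in> B" "n \<ge> 1" for s n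
    proof -
      have "(\<Sum>i = s..<s + n. a i) = (\<Sum>i<n. a (s + i))"
        using sum.shift_bounds_nat_ivl[of a 0 s n] by (simp add: lessThan_atLeast0 add.commute)
      also have "\<dots> = (\<Sum>i<n. indicator E1 ((y + real s *\<^sub>R \<alpha>) + real i *\<^sub>R \<alpha>) - r)"
        by (simp add: a_def algebra_simps)
      also have "1 / real q \<le> \<dots>"
        using heavy_nbhd_sum_ge[OF F(1) _ pq \<open>n \<ge> 1\<close>] \<open>s \<in> B\<close>
        by (simp add: B_def E1_def E2_def r_def)
      finally show ?thesis .
    qed
    \<comment> \<open>Here \<open>r \<le> tmu A \<le> 1\<close>, so a term of the sum is never below
      -1.\<close>
    moreover have "-1 \<le> a i" for i
      using order_trans[OF pq(2) mu] unfolding a_def r_def indicator_def by auto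
    moreover obtain l where "l \<in> B" "l \<le> L"
      using L[of y] F(2) by (auto simp: B_def E2_def tnbhd_def)
    ultimately have "1 / real q * (\<Sum>i<M. indicator B i) \<le> (\<Sum>i<M. a i) + real L"
      by (intro sum_ge_visits)
    moreover have "indicator B i = (indicator (J E2 i) y :: real)" for i
      using True by (simp add: B_def J_def indicator_def)
    moreover have "a i = indicator (J E1 i) y - r * indicator torus y" for i
      using True by (simp add: a_def J_def indicator_def)
    ultimately show ?thesis using True by simp
  next
    case False
    then show ?thesis by (simp add: J_def)
  qed
  have T: "torus \<in> fmeasurable (lborel :: (real^'n) measure)"
    using torus_fmeasurable[of UNIV] by simp
  have i1: "integrable lborel (indicator (J E1 i) :: _ \<Rightarrow> real)"
    and i2: "integrable lborel (indicator (J E2 i) :: _ \<Rightarrow> real)" for i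
    using J[of E1 i] J[of E2 i] by (auto intro!: integrable_real_indicator simp: fmeasurable_def)
  have i3: "integrable lborel (indicator torus :: real^'n \<Rightarrow> real)"
    using T by (auto intro!: integrable_real_indicator simp: fmeasurable_def)
  have bound: "1 / real q * (real M * m2) \<le> real M * (m1 - r) + real L" for M
  proof -
    have "(LINT y|lborel. 1 / real q * (\<Sum>i<M. indicator (J E2 i) y))
      \<le> (LINT y|lborel. (\<Sum>i<M. indicator (J E1 i) y - r * indicator torus y)
            + real L * indicator torus y)"
      using pointwise i1 i2 i3
      by (intro integral_mono) (auto intro!: integrable_mult_right Bochner_Integration.integrable_sum
          Bochner_Integration.integrable_add Bochner_Integration.integrable_diff)
    also have "(LINT y|lborel. 1 / real q * (\<Sum>i<M. indicator (J E2 i) y)) = 1 / real q * (real M * m2)"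
      using i2 by (simp add: Bochner_Integration.integral_sum mJ)
    also have "(LINT y|lborel. (\<Sum>i<M. indicator (J E1 i) y - r * indicator torus y)
            + real L * indicator torus y) = real M * (m1 - r) + real L"
      using i1 i3 by (simp add: Bochner_Integration.integral_sum mJ measure_torus)
    finally show ?thesis .
  qed
  have "1 / real q * m2 \<le> m1 - r"
  proof (rule ccontr)
    \<comment> \<open>In \<open>bound\<close> the error \<open>real L\<close> is fixed while the
      other terms grow linearly in \<open>M\<close>, so a large \<open>M\<close> gives a
      contradiction.\<close>
    assume "\<not> ?thesis"
    then have "0 < 1 / real q * m2 - (m1 - r)" by simp
    then obtain M :: nat where "real L < real M * (1 / real q * m2 - (m1 - r))"
      using reals_Archimedean3 by blast
    then show False using bound[of M] by (simp add: algebra_simps)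
  qed
  then have "m2 \<le> real q * (m1 - r)"
    using pq by (simp add: pos_divide_le_eq mult.commute)
  then show ?thesis
    by (simp only: m1_def m2_def E1_def E2_def r_def)
qed

lemma packing_number_heavy_le:
  fixes A :: "(real^'n) set"
  assumes A: "tclosed A" and \<alpha>: "generic \<alpha>" and e: "0 < e" "e \<le> 1/6"
    and pq: "0 < q" "of_int p / real q \<le> tmu A"
  shows "real (packing_number (heavy A \<alpha>) e)
    \<le> real q * (tmu A - of_int p / real q) / unit_ball_vol (real CARD('n)) * e powr (- real CARD('n))
      + 3 ^ CARD('n) * real q * real (packing_number (tboundary A) e)"
proof -
  define V where "V = unit_ball_vol (real CARD('n))"
  define D where "D = CARD('n)"
  define N where "N = real (packing_number (tboundary A) e)"
  have V: "V > 0" by (simp add: V_def)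
  obtain F where F: "packing (heavy A \<alpha>) e F" "packing_number (heavy A \<alpha>) e = card F"
    using packing_number_attained[of e "heavy A \<alpha>"] e by auto
  have mu: "tmu A \<le> 1"
  proof -
    have "A \<inter> torus = A" using A by (auto simp: tclosed_def)
    then show ?thesis
      using measure_subset_torus_le_1[OF tclosed_borel[OF A]] tclosed_borel[OF A]
      by (simp add: tmu_def measure_completion)
  qed
  have nonneg: "0 \<le> real q * (tmu A - of_int p / real q) / V * e powr (- real D)"
    "0 \<le> 3 ^ D * real q * N"
    using V pq by (simp_all add: N_def)
  show ?thesis
  proof (cases "F = {}")
    \<comment> \<open>The measure estimate needs a point of \<open>F\<close> whose neighbourhood is
      hit; without one the count is 0 and nonnegativity of the right-hand side suffices.\<close>
    case True
    then show ?thesis using nonneg F(2) by (simp add: V_def D_def N_def)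
  next
    case False
    then obtain x where "x \<in> F" by blast
    moreover have "F \<subseteq> heavy A \<alpha>" using F(1) by (simp add: packing_def)
    ultimately have "measure lborel (tnbhd F e \<inter> torus)
        \<le> real q * (measure lborel (tnbhd A e \<inter> torus) - of_int p / real q)"
      using measure_heavy_nbhd_le e(1) \<alpha> pq mu by blast
    also have "\<dots> \<le> real q * (tmu A + N * (V * (3 * e) ^ D) - of_int p / real q)"
      using measure_tnbhd_closed[OF A e]
      by (intro mult_left_mono) (simp_all add: V_def D_def N_def)
    also have "measure lborel (tnbhd F e \<inter> torus) = real (card F) * (V * e ^ D)"
      using measure_tnbhd_packing[OF F(1)] e by (simp add: V_def D_def)
    \<comment> \<open>Factor out the volume of one ball; \<open>3 ^ D\<close> is the quotient of
      \<open>(3 * e) ^ D\<close> by \<open>e ^ D\<close>.\<close>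
    also have "real q * (tmu A + N * (V * (3 * e) ^ D) - r)
        = (real q * (tmu A - r) / V * e powr (- real D) + 3 ^ D * real q * N) * (V * e ^ D)" for r
      using V e by (simp add: powr_minus powr_realpow field_simps power_mult_distrib)
    finally have "real (card F) * (V * e ^ D)
        \<le> (real q * (tmu A - of_int p / real q) / V * e powr (- real D) + 3 ^ D * real q * N) * (V * e ^ D)" .
    then show ?thesis
      using V e F(2) by (simp add: V_def D_def N_def)
  qed
qed

section \<open>Minkowski dimensions\<close>

text \<open>The constant \<open>C\<close> costs at most a further \<open>\<eta>\<close> in the
  exponent once \<open>e\<close> is small. The quantifier over \<open>N\<close> stands inside, so
  the threshold depends on \<open>C\<close> and \<open>\<eta>\<close> only.\<close>

lemma eventually_log_ratio_le:
  fixes t \<eta> C :: real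
  assumes "0 \<le> t" "0 < \<eta>"
  shows "\<forall>\<^sub>F e in at_right 0. \<forall>N::nat. real N \<le> C * e powr (- (t + \<eta>))
    \<longrightarrow> ln (real N) / (- ln e) \<le> t + 2 * \<eta>"
proof -
  \<comment> \<open>Replacing \<open>C\<close> by a constant at least 1 makes the logarithm
    meaningful; the bound \<open>b\<close> is chosen so that
    \<open>ln C' \<le> \<eta> * (- ln e)\<close> below it.\<close>
  define C' where "C' = max C 1"
  define b where "b = min 1 (exp (- ln C' / \<eta>))"
  have "b > 0" by (simp add: b_def)
  then have "\<forall>\<^sub>F e in at_right 0. e \<in> {0<..<b}"
    by (rule eventually_at_right_real)
  then show ?thesis
  proof eventually_elim
    case (elim e)
    then have e: "0 < e" "e < 1" "e < exp (- ln C' / \<eta>)" by (auto simp: b_def)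
    then have neg: "- ln e > 0" by simp
    have "ln e < - ln C' / \<eta>"
      using e ln_less_cancel_iff[of e "exp (- ln C' / \<eta>)"] by simp
    then have C': "ln C' \<le> \<eta> * (- ln e)"
      using assms by (simp add: field_simps)
    show ?case
    proof (intro allI impI)
      fix N :: nat assume N: "real N \<le> C * e powr (- (t + \<eta>))"
      show "ln (real N) / (- ln e) \<le> t + 2 * \<eta>"
      proof (cases "N = 0")
        \<comment> \<open>By convention \<open>ln 0 = 0\<close>, so the ratio is 0.\<close>
        case True
        then show ?thesis using assms by simp
      next
        case False
        have "C * e powr (- (t + \<eta>)) \<le> C' * e powr (- (t + \<eta>))"
          by (intro mult_right_mono) (auto simp: C'_def)
        then have "ln (real N) \<le> ln (C' * e powr (- (t + \<eta>)))"
          using N False by (intro ln_mono) auto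
        also have "\<dots> = ln C' + (t + \<eta>) * (- ln e)"
          using e by (subst ln_mult) (auto simp: C'_def ln_powr algebra_simps)
        also have "\<dots> \<le> (t + 2 * \<eta>) * (- ln e)"
          using C' by (simp add: algebra_simps)
        finally show ?thesis
          using neg by (subst pos_divide_le_eq) auto
      qed
    qed
  qed
qed

text \<open>A lower limit is controlled by arbitrarily small scales, so a bound holding frequently
  is enough.\<close>

lemma lower_mink_dim_leI:
  fixes S :: "(real^'n) set"
  assumes "0 \<le> t"
    and "\<And>\<eta>. \<eta> > 0 \<Longrightarrow> \<exists>\<^sub>F e in at_right 0. real (packing_number S e) \<le> C * e powr (- (t + \<eta>))"
  shows "lower_mink_dim S \<le> ereal t"
proof (rule ereal_le_epsilon2)
  fix \<epsilon> :: real assume \<epsilon>: "0 < \<epsilon>"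
  define f where "f e = ereal (ln (real (packing_number S e)) / (- ln e))" for e
  have freq: "\<exists>\<^sub>F e in at_right 0. f e \<le> ereal (t + \<epsilon>)"
  proof (rule frequently_rev_mp)
    show "\<exists>\<^sub>F e in at_right 0. real (packing_number S e) \<le> C * e powr (- (t + \<epsilon> / 2))"
      using assms(2) \<epsilon> by simp
    have "\<forall>\<^sub>F e in at_right 0. \<forall>N::nat. real N \<le> C * e powr (- (t + \<epsilon> / 2))
        \<longrightarrow> ln (real N) / (- ln e) \<le> t + 2 * (\<epsilon> / 2)"
      by (rule eventually_log_ratio_le) (use assms(1) \<epsilon> in simp_all)
    then show "\<forall>\<^sub>F e in at_right 0. real (packing_number S e) \<le> C * e powr (- (t + \<epsilon> / 2))
        \<longrightarrow> f e \<le> ereal (t + \<epsilon>)"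
      by eventually_elim (simp add: f_def)
  qed
  have "\<not> ereal (t + \<epsilon>) < Liminf (at_right 0) f"
  proof
    assume "ereal (t + \<epsilon>) < Liminf (at_right 0) f"
    then have "\<forall>\<^sub>F e in at_right 0. \<not> f e \<le> ereal (t + \<epsilon>)"
      unfolding not_le by (rule less_LiminfD)
    then show False using freq by (simp add: frequently_def)
  qed
  then show "lower_mink_dim S \<le> ereal t + ereal \<epsilon>"
    unfolding lower_mink_dim_def f_def[symmetric] by (simp add: not_less)
qed

lemma eventually_packing_number_le_dim:
  fixes S :: "(real^'n) set"
  assumes "\<eta> \<ge> 0"
  shows "\<forall>\<^sub>F e in at_right 0. real (packing_number S e)
    \<le> 1 / unit_ball_vol (real CARD('n)) * e powr (- (real CARD('n) + \<eta>))"
proof -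
  have "\<forall>\<^sub>F e in at_right (0::real). e \<in> {0<..<1/2}"
    by (rule eventually_at_right_real) simp
  then show ?thesis
  proof eventually_elim
    case (elim e)
    then have "real (packing_number S e) \<le> 1 / unit_ball_vol (real CARD('n)) * e powr (- real CARD('n))"
      by (intro packing_number_le) auto
    also have "\<dots> \<le> 1 / unit_ball_vol (real CARD('n)) * e powr (- (real CARD('n) + \<eta>))"
      using elim assms by (intro mult_left_mono powr_mono') auto
    finally show ?case .
  qed
qed

text \<open>Allows the extended-real dimension to be handled as a real number. An empty set is
  covered too, since \<open>ln 0 = 0\<close> gives it dimension 0.\<close>

lemma upper_mink_dim_bounds:
  fixes S :: "(real^'n) set"
  obtains d where "upper_mink_dim S = ereal d" "0 \<le> d" "d \<le> real CARD('n)"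
proof -
  define f where "f e = ereal (ln (real (packing_number S e)) / (- ln e))" for e
  have U: "upper_mink_dim S = Limsup (at_right 0) f"
    unfolding upper_mink_dim_def f_def by (rule refl)
  have le: "upper_mink_dim S \<le> ereal (real CARD('n))"
  proof (rule ereal_le_epsilon2)
    fix \<epsilon> :: real assume \<epsilon>: "0 < \<epsilon>"
    have "\<forall>\<^sub>F e in at_right 0. f e \<le> ereal (real CARD('n) + \<epsilon>)"
    proof -
      have \<epsilon>2: "\<epsilon> / 2 \<ge> 0" "\<epsilon> / 2 > 0" "0 \<le> real CARD('n)" using \<epsilon> by simp_all
      show ?thesis
        using eventually_packing_number_le_dim[OF \<epsilon>2(1), of S]
          eventually_log_ratio_le[OF \<epsilon>2(3,2), of "1 / unit_ball_vol (real CARD('n))"]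
        unfolding f_def by eventually_elim simp
    qed
    then show "upper_mink_dim S \<le> ereal (real CARD('n)) + ereal \<epsilon>"
      unfolding U by (simp add: Limsup_bounded)
  qed
  have ge: "0 \<le> upper_mink_dim S"
  proof -
    have "\<forall>\<^sub>F e in at_right (0::real). e \<in> {0<..<1}"
      by (rule eventually_at_right_real) simp
    then have "\<forall>\<^sub>F e in at_right 0. 0 \<le> f e"
    proof eventually_elim
      case (elim e)
      have "0 \<le> ln (real (packing_number S e))"
        by (cases "packing_number S e = 0") auto
      then show ?case using elim by (simp add: f_def divide_nonneg_neg)
    qed
    then show ?thesis
      unfolding U by (intro le_Limsup) auto
  qed
  obtain d where "upper_mink_dim S = ereal d"
    using le ge by (cases "upper_mink_dim S") simp_all
  then show thesis
    using that[of d] le ge by simp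
qed

lemma eventually_packing_number_le_upper_dim:
  fixes S :: "(real^'n) set"
  assumes "upper_mink_dim S = ereal d" "\<eta> > 0"
  shows "\<forall>\<^sub>F e in at_right 0. real (packing_number S e) \<le> e powr (- (d + \<eta>))"
proof -
  have "Limsup (at_right 0) (\<lambda>e. ereal (ln (real (packing_number S e)) / (- ln e))) < ereal (d + \<eta>)"
    unfolding upper_mink_dim_def[symmetric] using assms by simp
  then have "\<forall>\<^sub>F e in at_right 0. ln (real (packing_number S e)) / (- ln e) < d + \<eta>"
    by (drule_tac Limsup_lessD) simp
  moreover have "\<forall>\<^sub>F e in at_right (0::real). e \<in> {0<..<1}"
    by (rule eventually_at_right_real) simp
  ultimately show ?thesis
  proof eventually_elim
    case (elim e)
    show ?case
    proof (cases "packing_number S e = 0")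
      case False
      have "ln (real (packing_number S e)) < (d + \<eta>) * (- ln e)"
        using elim by (subst (asm) pos_divide_less_eq) auto
      also have "\<dots> = ln (e powr (- (d + \<eta>)))"
        using elim by (simp add: ln_powr algebra_simps)
      finally show ?thesis
        using False elim by (subst (asm) ln_less_cancel_iff) auto
    qed simp
  qed
qed

text \<open>A bounded interval contains only finitely many fractions with bounded denominator, while
  the approximating fractions are infinitely many.\<close>

lemma approx_from_below_unbounded:
  fixes p :: "nat \<Rightarrow> int" and q :: "nat \<Rightarrow> nat"
  assumes "\<And>i. q i > 0" "inj (\<lambda>i. of_int (p i) / real (q i) :: real)" "k \<ge> 0" "c > 0"
    and "\<And>i. 0 \<le> x - of_int (p i) / real (q i)"
    and "\<And>i. x - of_int (p i) / real (q i) < c / real (q i) powr k"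
  shows "\<exists>i. Q < real (q i)"
proof (rule ccontr)
  assume "\<not> ?thesis"
  then have qQ: "real (q i) \<le> Q" for i by (simp add: not_less)
  define B where "B = \<lceil>(\<bar>x\<bar> + c) * Q\<rceil>"
  have "(p i, q i) \<in> {-B..B} \<times> {..nat \<lfloor>Q\<rfloor>}" for i
  proof -
    have q: "0 < real (q i)" using assms(1) by simp
    \<comment> \<open>As denominators are at least 1, all fractions lie within \<open>c\<close> of
      \<open>x\<close>, which bounds the numerators by \<open>B\<close>.\<close>
    have "1 \<le> real (q i) powr k"
      using assms(1)[of i] assms(3) by (intro ge_one_powr_ge_zero) auto
    then have "c / real (q i) powr k \<le> c"
      using divide_left_mono[of 1 "real (q i) powr k" c] q assms(4) by force
    then have "\<bar>of_int (p i) / real (q i)\<bar> \<le> \<bar>x\<bar> + c"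
      using assms(5,6)[of i] by linarith
    then have "\<bar>of_int (p i)\<bar> \<le> (\<bar>x\<bar> + c) * real (q i)"
      using q by (simp add: abs_divide pos_divide_le_eq)
    also have "\<dots> \<le> (\<bar>x\<bar> + c) * Q"
      using qQ[of i] assms(4) by (intro mult_left_mono) auto
    finally have "\<bar>of_int (p i)\<bar> \<le> (of_int B :: real)"
      using le_of_int_ceiling[of "(\<bar>x\<bar> + c) * Q"] unfolding B_def by linarith
    then have "\<bar>p i\<bar> \<le> B" by linarith
    moreover have "q i \<le> nat \<lfloor>Q\<rfloor>" using qQ[of i] by (rule le_nat_floor)
    ultimately show ?thesis by (simp add: abs_le_iff)
  qed
  then have "range (\<lambda>i. (p i, q i)) \<subseteq> {-B..B} \<times> {..nat \<lfloor>Q\<rfloor>}"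
    by blast
  then have "finite (range (\<lambda>i. (p i, q i)))"
    by (rule finite_subset) simp
  moreover have "inj (\<lambda>i. (p i, q i))"
  proof (rule injI)
    fix i j assume "(p i, q i) = (p j, q j)"
    then show "i = j" by (intro injD[OF assms(2)]) simp
  qed
  ultimately show False
    using finite_imageD[of "\<lambda>i. (p i, q i)" UNIV] by simp
qed

section \<open>The two cases\<close>

lemma lower_mink_dim_heavy_rational:
  fixes A :: "(real^'n) set"
  assumes A: "tclosed A" and \<alpha>: "generic \<alpha>" and mu: "tmu A \<in> \<rat>"
  shows "lower_mink_dim (heavy A \<alpha>) \<le> upper_mink_dim (tboundary A)"
proof -
  obtain \<psi> where \<psi>: "upper_mink_dim (tboundary A) = ereal \<psi>" "0 \<le> \<psi>"
    using upper_mink_dim_bounds by blast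
  obtain p q' where pq': "tmu A = of_int p / of_int q'" "q' > 0"
    using mu by (elim Rats_cases') auto
  define q where "q = nat q'"
  have pq: "0 < q" "tmu A = of_int p / real q"
    using pq' by (simp_all add: q_def)
  have "lower_mink_dim (heavy A \<alpha>) \<le> ereal \<psi>"
  proof (rule lower_mink_dim_leI[where C = "3 ^ CARD('n) * real q"])
    fix \<eta> :: real assume "\<eta> > 0"
    have "\<forall>\<^sub>F e in at_right (0::real). e \<in> {0<..<1/6}"
      by (rule eventually_at_right_real) simp
    with eventually_packing_number_le_upper_dim[OF \<psi>(1) \<open>\<eta> > 0\<close>]
    have "\<forall>\<^sub>F e in at_right 0. real (packing_number (heavy A \<alpha>) e)
        \<le> 3 ^ CARD('n) * real q * e powr (- (\<psi> + \<eta>))"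
    proof eventually_elim
      case (elim e)
      have "real (packing_number (heavy A \<alpha>) e)
          \<le> 3 ^ CARD('n) * real q * real (packing_number (tboundary A) e)"
        using packing_number_heavy_le[OF A \<alpha>, of e q p] elim pq by simp
      also have "\<dots> \<le> 3 ^ CARD('n) * real q * e powr (- (\<psi> + \<eta>))"
        using elim by (intro mult_left_mono) auto
      finally show ?case .
    qed
    then show "\<exists>\<^sub>F e in at_right 0. real (packing_number (heavy A \<alpha>) e)
        \<le> 3 ^ CARD('n) * real q * e powr (- (\<psi> + \<eta>))"
      by (intro eventually_frequently) auto
  qed fact
  then show ?thesis by (simp add: \<psi>)
qed

lemma lower_mink_dim_heavy_approx:
  fixes A :: "(real^'n) set"
  assumes A: "tclosed A" and \<alpha>: "generic \<alpha>" and k: "k \<ge> 1" and approx: "approx_from_below (tmu A) k"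
  shows "lower_mink_dim (heavy A \<alpha>) \<le> upper_mink_dim (tboundary A)
    + (ereal (real CARD('n)) - upper_mink_dim (tboundary A)) / ereal k"
proof -
  define D where "D = real CARD('n)"
  define V where "V = unit_ball_vol D"
  have V: "V > 0" by (simp add: V_def D_def)
  obtain \<psi> where \<psi>: "upper_mink_dim (tboundary A) = ereal \<psi>" "0 \<le> \<psi>" "\<psi> \<le> D"
    unfolding D_def using upper_mink_dim_bounds by blast
  define s where "s = (D - \<psi>) / k"
  have "lower_mink_dim (heavy A \<alpha>) \<le> ereal (\<psi> + s)"
  proof (cases "\<psi> = D")
    \<comment> \<open>Here \<open>s = 0\<close> and no scale \<open>e\<close> can be chosen as
      below, but the claim is the trivial bound by the full dimension.\<close>
    case True
    have "lower_mink_dim (heavy A \<alpha>) \<le> ereal D"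
    proof (rule lower_mink_dim_leI[where C = "1 / V"])
      fix \<eta> :: real assume "\<eta> > 0"
      then show "\<exists>\<^sub>F e in at_right 0. real (packing_number (heavy A \<alpha>) e) \<le> 1 / V * e powr (- (D + \<eta>))"
        using eventually_packing_number_le_dim[of \<eta> "heavy A \<alpha>"] unfolding D_def V_def
        by (intro eventually_frequently) auto
    qed (simp add: D_def)
    then show ?thesis by (simp add: s_def True)
  next
    case False
    then have s: "s > 0" using \<psi> k by (simp add: s_def)
    obtain c and p :: "nat \<Rightarrow> int" and q :: "nat \<Rightarrow> nat" where c: "c > 0" and inj: "inj (\<lambda>i. of_int (p i) / real (q i) :: real)"
      and all: "\<forall>i. q i > 0 \<and> 0 \<le> tmu A - of_int (p i) / real (q i) \<and>
           tmu A - of_int (p i) / real (q i) < c / real (q i) powr k"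
      using approx unfolding approx_from_below_def by blast
    have q: "q i > 0" and below: "0 \<le> tmu A - of_int (p i) / real (q i)"
      and close: "tmu A - of_int (p i) / real (q i) < c / real (q i) powr k" for i
      using all[rule_format, of i] by simp_all
    \<comment> \<open>One summand for each of the two terms of
      \<open>packing_number_heavy_le\<close>; it depends neither on \<open>\<eta>\<close> nor on the
      chosen approximation.\<close>
    define C where "C = c / V + 3 ^ CARD('n)"
    show ?thesis
    proof (rule lower_mink_dim_leI[where C = C])
      show "0 \<le> \<psi> + s" using \<psi> s by simp
      fix \<eta> :: real assume \<eta>: "\<eta> > 0"
      show "\<exists>\<^sub>F e in at_right 0. real (packing_number (heavy A \<alpha>) e) \<le> C * e powr (- (\<psi> + s + \<eta>))"
        unfolding frequently_def
      proof
        assume "\<forall>\<^sub>F e in at_right 0. \<not> real (packing_number (heavy A \<alpha>) e) \<le> C * e powr (- (\<psi> + s + \<eta>))"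
        with eventually_packing_number_le_upper_dim[OF \<psi>(1) \<eta>]
        have "\<forall>\<^sub>F e in at_right 0. real (packing_number (tboundary A) e) \<le> e powr (- (\<psi> + \<eta>))
          \<and> \<not> real (packing_number (heavy A \<alpha>) e) \<le> C * e powr (- (\<psi> + s + \<eta>))"
          by (rule eventually_conj)
        then obtain b where b: "b > 0" and
          ev: "\<And>e. 0 < e \<Longrightarrow> e < b \<Longrightarrow> real (packing_number (tboundary A) e) \<le> e powr (- (\<psi> + \<eta>))
            \<and> \<not> real (packing_number (heavy A \<alpha>) e) \<le> C * e powr (- (\<psi> + s + \<eta>))"
          unfolding eventually_at_right_field by auto
        define b' where "b' = min b (1/6)"
        have b': "b' > 0" using b by (simp add: b'_def)
        \<comment> \<open>Denominators are unbounded, and this threshold is the one that puts the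
          scale \<open>e\<close> below \<open>b'\<close>.\<close>
        obtain i where i: "b' powr (- s) < real (q i)"
          using approx_from_below_unbounded[OF q inj _ c below close, of "b' powr (- s)"] k by auto
        \<comment> \<open>This scale balances the two terms:
          \<open>real (q i) = e powr (- s)\<close>, and because \<open>(D - \<psi>) / s = k\<close>
          the error \<open>c / real (q i) powr k\<close> equals
          \<open>c * e powr (D - \<psi>)\<close>. Both terms are then of order
          \<open>e powr (- (\<psi> + s))\<close>, up to \<open>\<eta>\<close>.\<close>
        define e where "e = real (q i) powr (- (1 / s))"
        have "e > 0" using q[of i] by (simp add: e_def)
        have qe: "e powr (- s) = real (q i)"
          using s q[of i] by (simp add: e_def powr_powr)
        have "e < b'"
        proof (rule ccontr)
          assume "\<not> ?thesis"
          then have "e powr (- s) \<le> b' powr (- s)"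
            using b' s by (intro powr_mono2') auto
          then show False using i qe by simp
        qed
        then have e: "e < b" "e \<le> 1/6" "e < 1" by (auto simp: b'_def)
        note N = conjunct1[OF ev[OF \<open>e > 0\<close> e(1)]]
        have "e powr (D - \<psi>) = real (q i) powr (- k)"
        proof -
          have "- (1 / s) * (D - \<psi>) = - k"
            using False k by (simp add: s_def)
          then show ?thesis by (simp only: e_def powr_powr)
        qed
        then have "c / real (q i) powr k = c * e powr (D - \<psi>)"
          by (simp add: powr_minus divide_inverse)
        then have "real (q i) * (tmu A - of_int (p i) / real (q i)) / V * e powr (- D)
            \<le> real (q i) * (c * e powr (D - \<psi>)) / V * e powr (- D)"
          using close[of i] V by (intro mult_right_mono divide_right_mono mult_left_mono) auto
        also have "\<dots> = c / V * (e powr (- s) * e powr (D - \<psi>) * e powr (- D))"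
          unfolding qe by (simp add: mult_ac)
        also have "e powr (- s) * e powr (D - \<psi>) * e powr (- D) = e powr (- (\<psi> + s))"
        proof -
          have "- (\<psi> + s) = - s + (D - \<psi>) + - D" by simp
          then show ?thesis by (simp only: powr_add)
        qed
        also have "c / V * e powr (- (\<psi> + s)) \<le> c / V * e powr (- (\<psi> + s + \<eta>))"
          using c V \<eta> \<open>e > 0\<close> e by (intro mult_left_mono powr_mono') auto
        finally have 1: "real (q i) * (tmu A - of_int (p i) / real (q i)) / V * e powr (- D)
            \<le> c / V * e powr (- (\<psi> + s + \<eta>))" .
        have "3 ^ CARD('n) * real (q i) * real (packing_number (tboundary A) e)
            \<le> 3 ^ CARD('n) * real (q i) * e powr (- (\<psi> + \<eta>))"
          using N by (intro mult_left_mono) auto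
        also have "\<dots> = 3 ^ CARD('n) * (e powr (- s) * e powr (- (\<psi> + \<eta>)))"
          unfolding qe by (simp add: mult_ac)
        also have "e powr (- s) * e powr (- (\<psi> + \<eta>)) = e powr (- (\<psi> + s + \<eta>))"
        proof -
          have "- (\<psi> + s + \<eta>) = - s + - (\<psi> + \<eta>)" by simp
          then show ?thesis by (simp only: powr_add)
        qed
        finally have 2: "3 ^ CARD('n) * real (q i) * real (packing_number (tboundary A) e)
            \<le> 3 ^ CARD('n) * e powr (- (\<psi> + s + \<eta>))" .
        have "of_int (p i) / real (q i) \<le> tmu A" using below[of i] by simp
        then have "real (packing_number (heavy A \<alpha>) e)
            \<le> real (q i) * (tmu A - of_int (p i) / real (q i)) / V * e powr (- D)
              + 3 ^ CARD('n) * real (q i) * real (packing_number (tboundary A) e)"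
          unfolding D_def V_def using packing_number_heavy_le[OF A \<alpha> \<open>e > 0\<close> e(2) q] by blast
        also have "\<dots> \<le> C * e powr (- (\<psi> + s + \<eta>))"
          unfolding C_def distrib_right using 1 2 by (rule add_mono)
        finally have "real (packing_number (heavy A \<alpha>) e) \<le> C * e powr (- (\<psi> + s + \<eta>))" .
        then show False using ev[OF \<open>e > 0\<close> e(1)] by blast
      qed
    qed
  qed
  then show ?thesis
    using k by (simp add: \<psi> s_def D_def)
qed

theorem theorem1:
  fixes A :: "(real^'n) set" and k :: real
  assumes "tclosed A"
  shows "(tmu A \<notin> \<rat> \<and> k \<ge> 1 \<and> approx_from_below (tmu A) k \<longrightarrow>
           (AE \<alpha> in lebesgue_on torus. heavy A \<alpha> = {} \<or>
              lower_mink_dim (heavy A \<alpha>) \<le> upper_mink_dim (tboundary A)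
                + (ereal (real CARD('n)) - upper_mink_dim (tboundary A)) / ereal k))
       \<and> (tmu A \<in> \<rat> \<longrightarrow>
           (AE \<alpha> in lebesgue_on torus. heavy A \<alpha> = {} \<or>
              lower_mink_dim (heavy A \<alpha>) \<le> upper_mink_dim (tboundary A)))"
proof (intro conjI impI)
  assume "tmu A \<notin> \<rat> \<and> k \<ge> 1 \<and> approx_from_below (tmu A) k"
  then have hyp: "k \<ge> 1" "approx_from_below (tmu A) k" by simp_all
  show "AE \<alpha> in lebesgue_on torus. heavy A \<alpha> = {} \<or>
      lower_mink_dim (heavy A \<alpha>) \<le> upper_mink_dim (tboundary A)
        + (ereal (real CARD('n)) - upper_mink_dim (tboundary A)) / ereal k"
    \<comment> \<open>The exceptional null set consists of the non-generic rotations and depends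
      neither on \<open>A\<close> nor on \<open>k\<close>.\<close>
    using AE_generic by eventually_elim (blast intro: lower_mink_dim_heavy_approx assms hyp)
next
  assume mu: "tmu A \<in> \<rat>"
  show "AE \<alpha> in lebesgue_on torus. heavy A \<alpha> = {} \<or>
      lower_mink_dim (heavy A \<alpha>) \<le> upper_mink_dim (tboundary A)"
    using AE_generic by eventually_elim (blast intro: lower_mink_dim_heavy_rational assms mu)
qed

end
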